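(* Let $f\colon I\to I$ be a long-zigzag map which is locally eventually onto, with critical set $C$, and suppose there exists $c\in C$ such that $c\in\omega(c)$. Then there exists an endpoint in $\varprojlim\{I,f\}$. If additionally the orbit $\mathrm{orb}(c)$ is infinite, then $\varprojlim\{I,f\}$ has uncountably many endpoints.
   Context: $I=[0,1]$, $\mathbb{N}=\{1,2,\dots\}$, $\mathbb{N}_0=\mathbb{N}\cup\{0\}$. A map $f\colon I\to I$ always means a continuous surjection; $f^n$ is the $n$-th iterate ($f^0=\mathrm{id}$). A point $c\in(0,1)$ is a critical point of $f$ if for every open $J\ni c$ the restriction $f|_J$ is not one-to-one. The critical set $C$ consists of all critical points of $f$ together with $0$ and $1$. For $x\in I$, $\mathrm{orb}(x)=\{f^n(x):n\ge 0\}$, and $\omega(x)$ is the set of all limit points (subsequential limits) of the sequence $(f^n(x))_{n\in\mathbb{N}}$. The inverse limit is $\varprojlim\{I,f\}=\{(x_0,x_1,\ldots)\in I^{\mathbb{N}_0}: f(x_i)=x_{i-1},\ i\in\mathbb{N}\}$ with the product topology. A point $x$ of a chainable continuum $K$ is an endpoint if for all subcontinua $A,B\subset K$ with $x\in A\cap B$ one has $A\subset B$ or $B\subset A$. Long-zigzag: $f\colon I\to I$ is long-zigzag if there exists $\varepsilon>0$ such that for every $n\in\mathbb{N}_0$ and every interval $[a,b]\subset I$ such that $f^n([a,b])=[f^n(a),f^n(b)]$ or $f^n([a,b])=[f^n(b),f^n(a)]$, $f^n(x)\notin\{f^n(a),f^n(b)\}$ for every $x\in(a,b)$, and $|f^n(a)-f^n(b)|<\varepsilon$,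 the map $f^n$ sends $[a,b]$ homeomorphically onto $f^n([a,b])$. Locally eventually onto: for every nondegenerate interval $[a,b]\subset I$ there exists $n\in\mathbb{N}$ such that $f^n([a,b])=I$. *)

theory Defs
  imports "HOL-Analysis.Analysis"
begin

text \<open>
  A map of the unit interval is a function on all of \<open>real\<close> of which only the values on
  \<open>{0..1}\<close> matter. Infinite sequences of points are elements of \<open>nat \<Rightarrow> real\<close>, whose type class
  topology is the product topology.
\<close>

definition interval_map :: "(real \<Rightarrow> real) \<Rightarrow> bool" where
  "interval_map f \<longleftrightarrow> continuous_on {0..1} f \<and> f ` {0..1} = {0..1}"

definition critical_point :: "(real \<Rightarrow> real) \<Rightarrow> real \<Rightarrow> bool" where
  "critical_point f c \<longleftrightarrow>
     c \<in> {0<..<1} \<and> (\<forall>J. openin (top_of_set {0..1}) J \<and> c \<in> J \<longrightarrow> \<not> inj_on f J)"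

definition critical_set :: "(real \<Rightarrow> real) \<Rightarrow> real set" where
  "critical_set f = {c. critical_point f c} \<union> {0, 1}"

definition orb :: "(real \<Rightarrow> real) \<Rightarrow> real \<Rightarrow> real set" where
  "orb f x = {(f ^^ n) x | n. True}"

text \<open>Limit points of the sequence of iterates, not accumulation points of the orbit as a set:
  a periodic point belongs to its own limit set.\<close>

definition omega_limit :: "(real \<Rightarrow> real) \<Rightarrow> real \<Rightarrow> real set" where
  "omega_limit f x =
     {y. \<exists>r :: nat \<Rightarrow> nat. strict_mono r \<and> (\<lambda>k. (f ^^ r k) x) \<longlonglongrightarrow> y}"

definition inverse_limit :: "(real \<Rightarrow> real) \<Rightarrow> (nat \<Rightarrow> real) set" where
  "inverse_limit f = {x. (\<forall>i. x i \<in> {0..1}) \<and> (\<forall>i. f (x (Suc i)) = x i)}"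

definition subcontinuum :: "'a :: topological_space set \<Rightarrow> 'a set \<Rightarrow> bool" where
  "subcontinuum A K \<longleftrightarrow> A \<subseteq> K \<and> A \<noteq> {} \<and> compact A \<and> connected A"

text \<open>The notion is meant for chainable continua \<open>K\<close>; inverse limits of interval maps are
  chainable.\<close>

definition endpoint_of :: "'a :: topological_space set \<Rightarrow> 'a \<Rightarrow> bool" where
  "endpoint_of K x \<longleftrightarrow>
     x \<in> K \<and>
     (\<forall>A B. subcontinuum A K \<and> subcontinuum B K \<and> x \<in> A \<inter> B \<longrightarrow> A \<subseteq> B \<or> B \<subseteq> A)"

text \<open>In the image condition below the two alternatives cover both orders of the endpoint values;
  the interval with the wrongly ordered endpoints is empty in Isabelle, so that at most one
  alternative can hold unless the values agree.\<close>

definition long_zigzag :: "(real \<Rightarrow> real) \<Rightarrow> bool" where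
  "long_zigzag f \<longleftrightarrow>
     (\<exists>\<epsilon>>0. \<forall>n a b.
        0 \<le> a \<and> a \<le> b \<and> b \<le> 1 \<and>
        ((f ^^ n) ` {a..b} = {(f ^^ n) a..(f ^^ n) b} \<or>
         (f ^^ n) ` {a..b} = {(f ^^ n) b..(f ^^ n) a}) \<and>
        (\<forall>x\<in>{a<..<b}. (f ^^ n) x \<notin> {(f ^^ n) a, (f ^^ n) b}) \<and>
        \<bar>(f ^^ n) a - (f ^^ n) b\<bar> < \<epsilon>
        \<longrightarrow> (\<exists>g. homeomorphism {a..b} ((f ^^ n) ` {a..b}) (f ^^ n) g))"

definition locally_eventually_onto :: "(real \<Rightarrow> real) \<Rightarrow> bool" where
  "locally_eventually_onto f \<longleftrightarrow>
     (\<forall>a b. 0 \<le> a \<and> a < b \<and> b \<le> 1 \<longrightarrow> (\<exists>n\<ge>1. (f ^^ n) ` {a..b} = {0..1}))"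

end

theory Submission imports Defs begin

text \<open>
  Suppose that \<open>x\<close> is not an endpoint, so that it lies in two subcontinua \<open>A\<close>, \<open>B\<close> that are not
  nested. At every sufficiently high level \<open>n\<close> the projections of \<open>A\<close> and \<open>B\<close> are then two
  overlapping intervals, neither inside the other, with union an interval from some \<open>\<alpha>\<close> to some
  \<open>\<beta>\<close> and with \<open>x n\<close> strictly in between. Because \<open>f\<close> is locally eventually onto, the projections
  of proper subcontinua shrink to points
  (\<open>proper_projections_shrink\<close>), so \<open>n\<close> can be taken with \<open>\<bar>\<alpha> - \<beta>\<bar>\<close> below the long-zigzag constant.
  For every \<open>k\<close>, the projections at level \<open>n + k\<close> contain an interval around
  \<open>x (n + k)\<close> on which \<open>f ^^ k\<close> runs from one of \<open>\<alpha>\<close>, \<open>\<beta>\<close> to the other without meeting them in the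
  interior (\<open>minimal_crossing_interval\<close>), and by the long-zigzag property \<open>f ^^ k\<close> is injective
  there. Thus a non-endpoint has, at some level, a fixed neighbourhood all of whose pullbacks along
  \<open>x\<close> are free of critical points (\<open>non_endpoint_injective_branches\<close>). Consequently, if at every
  level arbitrarily small neighbourhoods have a pullback along \<open>x\<close> that contains \<open>c\<close>, then \<open>x\<close> is
  an endpoint (\<open>endpoint_if_critical_nearby\<close>).

  Recurrence of \<open>c\<close> provides such \<open>x\<close>. Choose levels \<open>M 0 < M 1 < \<dots>\<close> and intervals \<open>V j\<close> around \<open>c\<close>
  such that \<open>f ^^ (M (j + 1) - M j)\<close> maps \<open>V (j + 1)\<close> into \<open>V j\<close> and all iterates up to \<open>M j\<close> keep \<open>V j\<close>
  small. These conditions determine a point \<open>x\<close> with \<open>x (M j) \<in> V j\<close> for all \<open>j\<close>. At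
  each stage an infinite orbit offers two return times with distinct values \<open>(f ^^ n) c\<close>; at least
  one of them makes \<open>x (M j)\<close> differ from a prescribed number. Hence \<open>x\<close> can be made
  different from every term of a given sequence of points, and the endpoints cannot be enumerated
  (\<open>recurrent_critical_endpoint_avoiding\<close>).
\<close>

section \<open>Iterates and projections of the inverse limit\<close>

abbreviation proj :: "nat \<Rightarrow> (nat \<Rightarrow> real) set \<Rightarrow> real set" where
  "proj n A \<equiv> (\<lambda>x. x n) ` A"

lemma funpow_in_unit:
  assumes "interval_map f" "t \<in> {0..1}"
  shows "(f ^^ n) t \<in> {0..1}"
  using assms by (induction n) (auto simp: interval_map_def)

lemma funpow_image_unit:
  assumes "interval_map f"
  shows "(f ^^ n) ` {0..1} = {0..1}"
proof (induction n)
  case (Suc n)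
  then show ?case
    using assms unfolding interval_map_def by (metis funpow.simps(2) image_comp)
qed simp

lemma continuous_on_funpow_unit:
  assumes "interval_map f"
  shows "continuous_on {0..1} (f ^^ n)"
proof (induction n)
  case (Suc n)
  show ?case
    unfolding funpow.simps(2)
    by (rule continuous_on_compose[OF Suc])
      (use assms in \<open>simp add: interval_map_def funpow_image_unit\<close>)
qed (simp add: id_def)

lemma inverse_limit_funpow:
  assumes "x \<in> inverse_limit f"
  shows "(f ^^ k) (x (n + k)) = x n"
proof (induction k)
  case (Suc k)
  then show ?case
    using assms by (simp add: inverse_limit_def funpow_Suc_right del: funpow.simps(2))
qed simp

lemma funpow_proj:
  assumes "A \<subseteq> inverse_limit f"
  shows "(f ^^ k) ` proj (n + k) A = proj n A"
  unfolding image_image using inverse_limit_funpow assms by (intro image_cong) blast+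

lemma proj_subset_unit:
  assumes "A \<subseteq> inverse_limit f"
  shows "proj n A \<subseteq> {0..1}"
  using assms by (auto simp: inverse_limit_def)

lemma subcontinuum_proj:
  assumes "subcontinuum A K"
  shows "compact (proj n A)" "connected (proj n A)"
  using assms unfolding subcontinuum_def
  by (auto intro!: compact_continuous_image connected_continuous_image continuous_on_product_coordinates
      intro: continuous_on_subset)

text \<open>
  Any \<open>a \<in> A\<close> agrees with some point of \<open>B\<close> in the coordinates up to \<open>n\<close>, because coordinate \<open>n\<close>
  determines all earlier ones. Letting \<open>n\<close> grow, these points of \<open>B\<close> converge to \<open>a\<close>.
\<close>
lemma subset_if_proj_subset:
  assumes A: "A \<subseteq> inverse_limit f" and B: "B \<subseteq> inverse_limit f" "compact B"
    and sub: "\<And>n. proj n A \<subseteq> proj n B"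
  shows "A \<subseteq> B"
proof
  fix a assume a: "a \<in> A"
  have "\<exists>b\<in>B. b n = a n" for n
    using sub[of n] a by (metis (no_types, lifting) image_iff subsetD)
  then obtain b where b: "\<And>n. b n \<in> B" "\<And>n. b n n = a n"
    by metis
  have eq: "b n i = a i" if "i \<le> n" for i n
    using inverse_limit_funpow[of "b n" f "n - i" i] inverse_limit_funpow[of a f "n - i" i]
      that a b A B(1) by fastforce
  have "(\<lambda>n. b n i) \<longlonglongrightarrow> a i" for i
    by (rule tendsto_eventually) (use eq in \<open>auto simp: eventually_sequentially\<close>)
  then have "b \<longlonglongrightarrow> a"
    by (simp add: limitin_componentwise flip: limitin_canonical_iff euclidean_product_topology)
  then show "a \<in> B"
    using closed_sequentially[of B b a] b(1) compact_imp_closed[OF B(2)] by blast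
qed

section \<open>Small projections\<close>

text \<open>
  Cut the unit interval into cells shorter than \<open>\<delta> / 2\<close>. Every interval of length \<open>\<delta>\<close> contains a
  cell, so it suffices that \<open>N\<close> serves the finitely many cells; once an iterate of a cell is the
  whole interval, all later iterates are.
\<close>
lemma uniformly_eventually_onto:
  assumes f: "interval_map f" and leo: "locally_eventually_onto f" and "\<delta> > 0"
  shows "\<exists>N. \<forall>a b. 0 \<le> a \<and> a + \<delta> \<le> b \<and> b \<le> 1 \<longrightarrow> (f ^^ N) ` {a..b} = {0..1}"
proof -
  obtain m :: nat where m: "m > 0" "2 / real m < \<delta>"
  proof -
    obtain m where "2 / \<delta> < real m" using reals_Archimedean2 by blast
    moreover have "0 < 2 / \<delta>" using \<open>\<delta> > 0\<close> by simp
    ultimately have "real m > 0" by linarith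
    moreover from this have "2 / real m < \<delta>"
      using \<open>2 / \<delta> < real m\<close> \<open>\<delta> > 0\<close> by (simp add: field_simps)
    ultimately show ?thesis using that by simp
  qed
  have "\<exists>N. (f ^^ N) ` {real i / m..(real i + 1) / m} = {0..1}" if "i < m" for i
  proof -
    have "0 \<le> real i / m" "real i / m < (real i + 1) / m" "(real i + 1) / m \<le> 1"
      using m(1) that by (simp_all add: divide_simps)
    then show ?thesis
      using leo unfolding locally_eventually_onto_def by blast
  qed
  then obtain N where N: "\<And>i. i < m \<Longrightarrow> (f ^^ N i) ` {real i / m..(real i + 1) / m} = {0..1}"
    by metis
  define M where "M = sum N {..<m}"
  have "(f ^^ M) ` {a..b} = {0..1}" if ab: "0 \<le> a" "a + \<delta> \<le> b" "b \<le> 1" for a b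
  proof -
    define i where "i = nat \<lceil>a * m\<rceil>"
    have i: "a * m \<le> i" "i < a * m + 1"
      using ab(1) unfolding i_def by (auto simp: of_nat_nat) linarith+
    have "a \<le> real i / m"
      using i(1) m(1) by (simp add: field_simps)
    moreover have "(real i + 1) / m < (a * m + 2) / m"
      using i(2) m(1) by (intro divide_strict_right_mono) auto
    then have "(real i + 1) / m < a + 2 / m"
      using m(1) by (simp add: add_divide_distrib)
    ultimately have cell: "a \<le> real i / m" "(real i + 1) / m < b"
      using m ab by linarith+
    have "(real i + 1) / m < 1" using cell ab by linarith
    then have "i < m" using m(1) by (simp add: field_simps)
    then have "N i \<le> M" unfolding M_def by (intro member_le_sum) auto
    then have "f ^^ M = (f ^^ (M - N i)) \<circ> (f ^^ N i)"
      by (simp flip: funpow_add)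
    then have "(f ^^ M) ` {real i / m..(real i + 1) / m} = {0..1}"
      using N[OF \<open>i < m\<close>] funpow_image_unit[OF f] by (metis image_comp)
    moreover have "{real i / m..(real i + 1) / m} \<subseteq> {a..b}"
      using cell by auto
    moreover have "(f ^^ M) ` {a..b} \<subseteq> {0..1}"
      using funpow_in_unit[OF f, of _ M] ab \<open>\<delta> > 0\<close> by fastforce
    ultimately show ?thesis by blast
  qed
  then show ?thesis by blast
qed

text \<open>
  An interval of length \<open>\<delta>\<close> in the projection to level \<open>n + N\<close> would spread over the whole unit
  interval at level \<open>n\<close>. The same \<open>N\<close> works for all subcontinua and all levels, so that
  two subcontinua can be made small at a common level.
\<close>
lemma proper_projections_shrink:
  assumes f: "interval_map f" and leo: "locally_eventually_onto f" and "\<delta> > 0"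
  shows "\<exists>N. \<forall>A n. subcontinuum A (inverse_limit f) \<and> proj n A \<noteq> {0..1} \<longrightarrow>
    (\<forall>s\<in>proj (n + N) A. \<forall>t\<in>proj (n + N) A. \<bar>s - t\<bar> < \<delta>)"
proof -
  obtain N where N: "\<And>a b. 0 \<le> a \<Longrightarrow> a + \<delta> \<le> b \<Longrightarrow> b \<le> 1 \<Longrightarrow> (f ^^ N) ` {a..b} = {0..1}"
    using uniformly_eventually_onto[OF assms] by blast
  have short: "t < s + \<delta>"
    if A: "subcontinuum A (inverse_limit f)" "proj n A \<noteq> {0..1}"
      and st: "s \<in> proj (n + N) A" "t \<in> proj (n + N) A" for A n s t
  proof (rule ccontr)
    assume "\<not> t < s + \<delta>"
    have AX: "A \<subseteq> inverse_limit f" using A(1) by (simp add: subcontinuum_def)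
    have "s \<in> {0..1}" "t \<in> {0..1}"
      using proj_subset_unit[OF AX, of "n + N"] st by blast+
    then have "(f ^^ N) ` {s..t} = {0..1}"
      using N[of s t] \<open>\<not> t < s + \<delta>\<close> by simp
    moreover have "{s..t} \<subseteq> proj (n + N) A"
      using connected_contains_Icc[OF subcontinuum_proj(2)[OF A(1)] st] .
    ultimately have "{0..1} \<subseteq> proj n A"
      using funpow_proj[OF AX, of N n] by blast
    then show False using proj_subset_unit[OF AX, of n] A(2) by blast
  qed
  have "\<bar>s - t\<bar> < \<delta>"
    if "subcontinuum A (inverse_limit f)" "proj n A \<noteq> {0..1}"
      and "s \<in> proj (n + N) A" "t \<in> proj (n + N) A" for A n s t
    using short[OF that] short[OF that(1,2,4,3)] by linarith
  then show ?thesis by blast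
qed

section \<open>Injective branches around a non-endpoint\<close>

text \<open>
  The unordered segment from a point \<open>\<alpha>\<close> of \<open>A\<close> to a point \<open>\<beta>\<close> of \<open>B\<close> treats both relative
  positions of the two intervals alike.
\<close>
lemma union_of_crossing_intervals:
  fixes A B :: "real set"
  assumes A: "compact A" "connected A" and B: "compact B" "connected B"
    and "p \<in> A \<inter> B" "\<not> A \<subseteq> B" "\<not> B \<subseteq> A"
  obtains \<alpha> \<beta> where "\<alpha> \<in> A - B" "\<beta> \<in> B - A" "A \<union> B = closed_segment \<alpha> \<beta>"
proof -
  obtain a b c d where ab: "A = {a..b}" and cd: "B = {c..d}"
    using A B connected_compact_interval_1 by metis
  have "(a < c \<and> b < d) \<or> (c < a \<and> d < b)"
    using assms(5-) unfolding ab cd by auto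
  then show thesis
  proof
    assume "a < c \<and> b < d"
    then show thesis
      using that[of a d] assms(5) unfolding ab cd by (force simp: closed_segment_eq_real_ivl)
  next
    assume "c < a \<and> d < b"
    then show thesis
      using that[of b c] assms(5) unfolding ab cd by (force simp: closed_segment_eq_real_ivl)
  qed
qed

text \<open>
  Take the points of \<open>A\<close> with value \<open>\<alpha>\<close> and of \<open>B\<close> with value \<open>\<beta>\<close> that are nearest to \<open>p\<close>. They
  lie on opposite sides of \<open>p\<close>: on the same side, the nearer one would belong to both intervals.
  Between them neither value recurs, since \<open>A\<close> avoids \<open>\<beta>\<close>, \<open>B\<close> avoids \<open>\<alpha>\<close>, and nearer points
  with the same value are excluded.
\<close>
lemma minimal_crossing_interval:
  fixes A B :: "real set" and g :: "real \<Rightarrow> real"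
  assumes A: "compact A" "connected A" and B: "compact B" "connected B"
    and g: "continuous_on (A \<union> B) g" and p: "p \<in> A \<inter> B"
    and \<alpha>: "\<alpha> \<in> g ` A" "\<alpha> \<notin> g ` B" and \<beta>: "\<beta> \<in> g ` B" "\<beta> \<notin> g ` A"
  obtains a b where "a < p" "p < b" "{a..b} \<subseteq> A \<union> B" "{g a, g b} = {\<alpha>, \<beta>}"
    "\<forall>x\<in>{a<..<b}. g x \<notin> {\<alpha>, \<beta>}"
proof -
  have nearest: "\<exists>u\<in>S. g u = y \<and> (\<forall>t\<in>S. g t = y \<longrightarrow> \<bar>p - u\<bar> \<le> \<bar>p - t\<bar>)"
    if S: "compact S" "continuous_on S g" "y \<in> g ` S" for S y
  proof -
    have "closed (S \<inter> g -` {y})"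
      using continuous_closed_preimage[OF S(2) compact_imp_closed[OF S(1)] closed_singleton] .
    moreover have "S \<inter> g -` {y} \<noteq> {}" using S(3) by auto
    ultimately obtain u where "u \<in> S \<inter> g -` {y}" "\<And>t. t \<in> S \<inter> g -` {y} \<Longrightarrow> dist p u \<le> dist p t"
      using distance_attains_inf[of "S \<inter> g -` {y}" p] by metis
    then show ?thesis by (auto simp: dist_real_def)
  qed
  have gA: "continuous_on A g" and gB: "continuous_on B g"
    using g continuous_on_subset by blast+
  obtain u where u: "u \<in> A" "g u = \<alpha>" "\<And>t. t \<in> A \<Longrightarrow> g t = \<alpha> \<Longrightarrow> \<bar>p - u\<bar> \<le> \<bar>p - t\<bar>"
    using nearest[OF A(1) gA \<alpha>(1)] by blast
  obtain v where v: "v \<in> B" "g v = \<beta>" "\<And>t. t \<in> B \<Longrightarrow> g t = \<beta> \<Longrightarrow> \<bar>p - v\<bar> \<le> \<bar>p - t\<bar>"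
    using nearest[OF B(1) gB \<beta>(1)] by blast
  have notin: "u \<notin> B" "v \<notin> A" using u v \<alpha> \<beta> by auto
  have icc: "{s..t} \<subseteq> A" if "s \<in> A" "t \<in> A" for s t
    using connected_contains_Icc[OF A(2) that] .
  have icc': "{s..t} \<subseteq> B" if "s \<in> B" "t \<in> B" for s t
    using connected_contains_Icc[OF B(2) that] .
  have pA: "p \<in> A" and pB: "p \<in> B" using p by auto
  have hitA: "g x \<notin> {\<alpha>, \<beta>}" if "x \<in> A" "\<bar>p - x\<bar> < \<bar>p - u\<bar>" for x
    using u(3)[of x] that \<beta>(2) by auto
  have hitB: "g x \<notin> {\<alpha>, \<beta>}" if "x \<in> B" "\<bar>p - x\<bar> < \<bar>p - v\<bar>" for x
    using v(3)[of x] that \<alpha>(2) by auto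
  consider "u < p" "p < v" | "v < p" "p < u"
  proof -
    have "u \<noteq> p" "v \<noteq> p" using notin pA pB by auto
    moreover have False if "u < p" "v < p"
      using icc[OF u(1) pA] icc'[OF v(1) pB] notin that
      by (cases "u \<le> v") (auto simp: subset_iff)
    moreover have False if "p < u" "p < v"
      using icc[OF pA u(1)] icc'[OF pB v(1)] notin that
      by (cases "u \<le> v") (auto simp: subset_iff)
    ultimately show thesis using that by (metis linorder_neq_iff)
  qed
  then show thesis
  proof cases
    case 1
    have sub: "{u..p} \<subseteq> A" "{p..v} \<subseteq> B" using icc icc' u v pA pB by blast+
    show thesis
    proof (rule that[of u v])
      show "{u..v} \<subseteq> A \<union> B"
        using sub 1 ivl_disj_un_two_touch(4)[of u p v] by auto
      show "\<forall>x\<in>{u<..<v}. g x \<notin> {\<alpha>, \<beta>}"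
      proof
        fix x assume x: "x \<in> {u<..<v}"
        show "g x \<notin> {\<alpha>, \<beta>}"
        proof (cases "x \<le> p")
          case True
          then show ?thesis by (intro hitA) (use x sub in auto)
        next
          case False
          then show ?thesis by (intro hitB) (use x sub in auto)
        qed
      qed
    qed (use 1 u v in auto)
  next
    case 2
    have sub: "{p..u} \<subseteq> A" "{v..p} \<subseteq> B" using icc icc' u v pA pB by blast+
    show thesis
    proof (rule that[of v u])
      show "{v..u} \<subseteq> A \<union> B"
        using sub 2 ivl_disj_un_two_touch(4)[of v p u] by auto
      show "\<forall>x\<in>{v<..<u}. g x \<notin> {\<alpha>, \<beta>}"
      proof
        fix x assume x: "x \<in> {v<..<u}"
        show "g x \<notin> {\<alpha>, \<beta>}"
        proof (cases "x \<le> p")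
          case True
          then show ?thesis by (intro hitB) (use x sub in auto)
        next
          case False
          then show ?thesis by (intro hitA) (use x sub in auto)
        qed
      qed
    qed (use 2 u v in auto)
  qed
qed

text \<open>
  The level \<open>n\<close> and the values \<open>\<alpha>\<close>, \<open>\<beta>\<close> do not depend on \<open>k\<close>: the long-zigzag constant bounds the
  length of the image interval uniformly in the number of iterations.
\<close>
lemma non_endpoint_injective_branches:
  assumes f: "interval_map f" and lz: "long_zigzag f" and leo: "locally_eventually_onto f"
    and x: "x \<in> inverse_limit f" "\<not> endpoint_of (inverse_limit f) x"
  obtains n \<alpha> \<beta> where "x n \<in> open_segment \<alpha> \<beta>"
    "\<And>k. \<exists>a b. 0 \<le> a \<and> a < x (n + k) \<and> x (n + k) < b \<and> b \<le> 1 \<and>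
       {(f ^^ k) a, (f ^^ k) b} = {\<alpha>, \<beta>} \<and> inj_on (f ^^ k) {a..b}"
proof -
  obtain \<epsilon> where "\<epsilon> > 0" and \<epsilon>: "\<And>n a b. 0 \<le> a \<Longrightarrow> a \<le> b \<Longrightarrow> b \<le> 1 \<Longrightarrow>
      (f ^^ n) ` {a..b} = {(f ^^ n) a..(f ^^ n) b} \<or> (f ^^ n) ` {a..b} = {(f ^^ n) b..(f ^^ n) a} \<Longrightarrow>
      \<forall>x\<in>{a<..<b}. (f ^^ n) x \<notin> {(f ^^ n) a, (f ^^ n) b} \<Longrightarrow>
      \<bar>(f ^^ n) a - (f ^^ n) b\<bar> < \<epsilon> \<Longrightarrow>
      \<exists>g. homeomorphism {a..b} ((f ^^ n) ` {a..b}) (f ^^ n) g"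
    using lz unfolding long_zigzag_def by blast
  obtain A B where A: "subcontinuum A (inverse_limit f)" and B: "subcontinuum B (inverse_limit f)"
    and xAB: "x \<in> A" "x \<in> B" and nest: "\<not> A \<subseteq> B" "\<not> B \<subseteq> A"
    using x unfolding endpoint_of_def by auto
  have AX: "A \<subseteq> inverse_limit f" "compact A" and BX: "B \<subseteq> inverse_limit f" "compact B"
    using A B by (auto simp: subcontinuum_def)
  obtain i where i: "\<not> proj i A \<subseteq> proj i B"
    using subset_if_proj_subset[OF AX(1) BX] nest by blast
  obtain j where j: "\<not> proj j B \<subseteq> proj j A"
    using subset_if_proj_subset[OF BX(1) AX] nest by blast
  \<comment> \<open>A failed inclusion of projections persists at all higher levels.\<close>
  define m where "m = i + j"
  have m: "\<not> proj (m + k) A \<subseteq> proj (m + k) B" "\<not> proj (m + k) B \<subseteq> proj (m + k) A" for k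
  proof -
    show "\<not> proj (m + k) A \<subseteq> proj (m + k) B"
      using funpow_proj[OF AX(1), of "j + k" i] funpow_proj[OF BX(1), of "j + k" i] i
      unfolding m_def by (metis add.assoc image_mono)
    show "\<not> proj (m + k) B \<subseteq> proj (m + k) A"
      using funpow_proj[OF AX(1), of "i + k" j] funpow_proj[OF BX(1), of "i + k" j] j
      unfolding m_def by (metis add.assoc add.commute image_mono)
  qed
  have proper: "proj m A \<noteq> {0..1}" "proj m B \<noteq> {0..1}"
    using m[of 0] proj_subset_unit[OF AX(1), of m] proj_subset_unit[OF BX(1), of m] by auto
  obtain N where N: "\<And>A n s t. subcontinuum A (inverse_limit f) \<Longrightarrow> proj n A \<noteq> {0..1} \<Longrightarrow>
      s \<in> proj (n + N) A \<Longrightarrow> t \<in> proj (n + N) A \<Longrightarrow> \<bar>s - t\<bar> < \<epsilon> / 2"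
    using proper_projections_shrink[OF f leo, of "\<epsilon> / 2"] \<open>\<epsilon> > 0\<close> by fastforce
  define n where "n = m + N"
  have xn: "x k \<in> proj k A \<inter> proj k B" for k using xAB by auto
  obtain \<alpha> \<beta> where \<alpha>: "\<alpha> \<in> proj n A - proj n B" and \<beta>: "\<beta> \<in> proj n B - proj n A"
    and un: "proj n A \<union> proj n B = closed_segment \<alpha> \<beta>"
    using union_of_crossing_intervals[OF subcontinuum_proj[OF A] subcontinuum_proj[OF B] xn] m[of N]
    unfolding n_def by metis
  have "\<bar>\<alpha> - x n\<bar> < \<epsilon> / 2" "\<bar>\<beta> - x n\<bar> < \<epsilon> / 2"
    using N[OF A proper(1), of \<alpha> "x n"] N[OF B proper(2), of \<beta> "x n"] \<alpha> \<beta> xn[of n]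
    unfolding n_def by auto
  then have close: "\<bar>\<alpha> - \<beta>\<bar> < \<epsilon>" by linarith
  show thesis
  proof (rule that[of n \<alpha> \<beta>])
    show "x n \<in> open_segment \<alpha> \<beta>"
      using un xn[of n] \<alpha> \<beta> unfolding open_segment_def by blast
    fix k
    let ?g = "f ^^ k" and ?A = "proj (n + k) A" and ?B = "proj (n + k) B"
    have im: "?g ` ?A = proj n A" "?g ` ?B = proj n B"
      using funpow_proj AX(1) BX(1) by blast+
    have unit: "?A \<union> ?B \<subseteq> {0..1}"
      using proj_subset_unit[OF AX(1)] proj_subset_unit[OF BX(1)] by blast
    have cont: "continuous_on (?A \<union> ?B) ?g"
      using continuous_on_subset[OF continuous_on_funpow_unit[OF f] unit] .
    obtain a b where ab: "a < x (n + k)" "x (n + k) < b" "{a..b} \<subseteq> ?A \<union> ?B"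
      "{?g a, ?g b} = {\<alpha>, \<beta>}" "\<forall>x\<in>{a<..<b}. ?g x \<notin> {\<alpha>, \<beta>}"
      using minimal_crossing_interval[OF subcontinuum_proj[OF A] subcontinuum_proj[OF B] cont xn,
          of \<alpha> \<beta>] \<alpha> \<beta> unfolding im by blast
    have seg: "closed_segment (?g a) (?g b) = closed_segment \<alpha> \<beta>"
      using ab(4) closed_segment_commute by (metis doubleton_eq_iff)
    have "?g ` {a..b} \<subseteq> closed_segment \<alpha> \<beta>"
      using ab(3) im un by blast
    moreover have "connected (?g ` {a..b})"
      by (rule connected_continuous_image[OF continuous_on_subset[OF cont ab(3)]]) simp
    then have "closed_segment (?g a) (?g b) \<subseteq> ?g ` {a..b}"
      using ab by (intro closed_segment_subset) (auto simp flip: connected_convex_1)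
    ultimately have "?g ` {a..b} = closed_segment (?g a) (?g b)"
      using seg by blast
    moreover have "a \<in> {a..b}" "b \<in> {a..b}" using ab(1,2) by auto
    then have "0 \<le> a" "b \<le> 1" using ab(3) unit by (meson atLeastAtMost_iff subsetD)+
    moreover have "\<bar>?g a - ?g b\<bar> < \<epsilon>"
      using close ab(4) by (auto simp: doubleton_eq_iff)
    ultimately have "\<exists>h. homeomorphism {a..b} (?g ` {a..b}) ?g h"
      using \<epsilon>[of a b k] ab(1,2,4,5) unfolding closed_segment_eq_real_ivl
      by (simp split: if_splits)
    then have "inj_on ?g {a..b}"
      unfolding homeomorphism_def by (metis inj_onI)
    then show "\<exists>a b. 0 \<le> a \<and> a < x (n + k) \<and> x (n + k) < b \<and> b \<le> 1 \<and>
       {?g a, ?g b} = {\<alpha>, \<beta>} \<and> inj_on ?g {a..b}"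
      using ab \<open>0 \<le> a\<close> \<open>b \<le> 1\<close> by blast
  qed
qed

section \<open>A sufficient condition for endpoints\<close>

text \<open>
  If \<open>x\<close> were not an endpoint, take \<open>e\<close> so small that the \<open>e\<close>-neighbourhood of \<open>x n\<close> misses \<open>\<alpha>\<close>
  and \<open>\<beta>\<close>. The connected set \<open>W\<close> cannot leave the interval on which \<open>f ^^ k\<close>, and therefore \<open>f\<close>,
  is injective, so \<open>c\<close> would have a neighbourhood where \<open>f\<close> is injective. This also
  rules out \<open>c = 0\<close> and \<open>c = 1\<close>, as \<open>c\<close> is interior to that interval.
\<close>
lemma endpoint_if_critical_nearby:
  assumes f: "interval_map f" and lz: "long_zigzag f" and leo: "locally_eventually_onto f"
    and x: "x \<in> inverse_limit f" and c: "c \<in> critical_set f"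
    and near: "\<And>n e. e > 0 \<Longrightarrow> \<exists>k\<ge>1. \<exists>W. connected W \<and> x (n + k) \<in> W \<and> c \<in> W \<and>
      (\<forall>t\<in>W. \<bar>(f ^^ k) t - x n\<bar> < e)"
  shows "endpoint_of (inverse_limit f) x"
proof (rule ccontr)
  assume "\<not> endpoint_of (inverse_limit f) x"
  from non_endpoint_injective_branches[OF f lz leo x this]
  obtain n \<alpha> \<beta> where n: "x n \<in> open_segment \<alpha> \<beta>"
    and br: "\<And>k. \<exists>a b. 0 \<le> a \<and> a < x (n + k) \<and> x (n + k) < b \<and> b \<le> 1 \<and>
       {(f ^^ k) a, (f ^^ k) b} = {\<alpha>, \<beta>} \<and> inj_on (f ^^ k) {a..b}"
    by blast
  have "min \<bar>\<alpha> - x n\<bar> \<bar>\<beta> - x n\<bar> > 0"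
    using n by (auto simp: open_segment_def)
  then obtain k W where k: "k \<ge> 1" and W: "connected W" "x (n + k) \<in> W" "c \<in> W"
    and small: "\<And>t. t \<in> W \<Longrightarrow> \<bar>(f ^^ k) t - x n\<bar> < min \<bar>\<alpha> - x n\<bar> \<bar>\<beta> - x n\<bar>"
    using near by meson
  obtain a b where ab: "0 \<le> a" "a < x (n + k)" "x (n + k) < b" "b \<le> 1"
      "{(f ^^ k) a, (f ^^ k) b} = {\<alpha>, \<beta>}" and inj: "inj_on (f ^^ k) {a..b}"
    using br by blast
  have "a \<notin> W" "b \<notin> W"
    using small[of a] small[of b] ab(5) by (auto simp: doubleton_eq_iff)
  then have cab: "c \<in> {a<..<b}"
    using connected_contains_Icc[OF W(1,3,2)] connected_contains_Icc[OF W(1,2,3)] ab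
    by (auto simp: not_less subset_iff)
  then have "critical_point f c"
    using c ab by (auto simp: critical_set_def)
  moreover have "openin (top_of_set {0..1}) {a<..<b}"
    using ab by (intro open_subset) auto
  ultimately have "\<not> inj_on f {a<..<b}"
    using cab by (auto simp: critical_point_def)
  moreover have "f ^^ k = (f ^^ (k - 1)) \<circ> f"
    using k by (metis Suc_diff_le diff_Suc_1 funpow_Suc_right One_nat_def Suc_pred' le_simps(3))
  then have "inj_on f {a..b}" using inj by (metis inj_on_imageI2)
  ultimately show False
    using inj_on_subset[of f "{a..b}" "{a<..<b}"] by force
qed

section \<open>Endpoints from a recurrent critical point\<close>

lemma funpow_equicontinuous_at:
  assumes f: "interval_map f" and c: "c \<in> {0..1}" and "e > 0"
  shows "\<exists>\<delta>>0. \<forall>i\<le>M. \<forall>t\<in>{0..1}. \<bar>t - c\<bar> \<le> \<delta> \<longrightarrow> \<bar>(f ^^ i) t - (f ^^ i) c\<bar> < e"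
proof (induction M)
  have one: "\<exists>\<delta>>0. \<forall>t\<in>{0..1}. \<bar>t - c\<bar> \<le> \<delta> \<longrightarrow> \<bar>(f ^^ i) t - (f ^^ i) c\<bar> < e" for i
  proof -
    obtain d where "d > 0" "\<forall>t\<in>{0..1}. dist t c < d \<longrightarrow> dist ((f ^^ i) t) ((f ^^ i) c) < e"
      using continuous_on_funpow_unit[OF f, of i] c \<open>e > 0\<close> unfolding continuous_on_iff by metis
    then show ?thesis by (intro exI[of _ "d / 2"]) (auto simp: dist_real_def)
  qed
  case 0
  show ?case using one[of 0] by simp
  case (Suc M)
  then obtain d where d: "d > 0" "\<forall>i\<le>M. \<forall>t\<in>{0..1}. \<bar>t - c\<bar> \<le> d \<longrightarrow> \<bar>(f ^^ i) t - (f ^^ i) c\<bar> < e"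
    by blast
  obtain d' where d': "d' > 0"
      "\<forall>t\<in>{0..1}. \<bar>t - c\<bar> \<le> d' \<longrightarrow> \<bar>(f ^^ Suc M) t - (f ^^ Suc M) c\<bar> < e"
    using one by blast
  show ?case
    by (intro exI[of _ "min d d'"]) (use d d' in \<open>auto simp: le_Suc_eq\<close>)
qed

text \<open>
  The hypothesis on returns lets a diagonal argument be run along the construction of \<open>x\<close>: the
  step from level \<open>M j\<close> to the next one keeps \<open>x (M j)\<close> away from \<open>z j (M j)\<close>.
\<close>
lemma recurrent_critical_endpoint_avoiding:
  fixes z :: "nat \<Rightarrow> nat \<Rightarrow> real"
  assumes f: "interval_map f" and lz: "long_zigzag f" and leo: "locally_eventually_onto f"
    and c: "c \<in> critical_set f"
    and rec: "\<And>j m e. e > 0 \<Longrightarrow> \<exists>n\<ge>1. \<bar>(f ^^ n) c - c\<bar> < e \<and> (f ^^ n) c \<noteq> z j m"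
  obtains x where "endpoint_of (inverse_limit f) x" "\<And>j. x \<noteq> z j"
proof -
  have cI: "c \<in> {0..1}" using c by (auto simp: critical_set_def critical_point_def)
  define W where "W d = {0..1} \<inter> cball c d" for d
  have W_iff: "t \<in> W d \<longleftrightarrow> t \<in> {0..1} \<and> \<bar>t - c\<bar> \<le> d" for t d
    unfolding W_def by (simp add: dist_real_def abs_minus_commute)
  \<comment> \<open>A state is a pair of a level and the radius of an interval around \<open>c\<close>.\<close>
  define P where "P j s \<longleftrightarrow> snd s > 0 \<and>
      (\<forall>i\<le>fst s. \<forall>t\<in>W (snd s). \<bar>(f ^^ i) t - (f ^^ i) c\<bar> < 1 / (real j + 1))"
    for j :: nat and s :: "nat \<times> real"
  define Q where "Q j s s' \<longleftrightarrow> (\<exists>n\<ge>1. fst s' = fst s + n \<and>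
      (f ^^ n) ` W (snd s') \<subseteq> W (snd s) - {z j (fst s)})" for j :: nat and s s' :: "nat \<times> real"
  have "\<exists>S. \<forall>j. P j (S j) \<and> Q j (S j) (S (Suc j))"
  proof (rule dependent_nat_choice)
    obtain d where "d > 0" "\<forall>i\<le>0. \<forall>t\<in>{0..1}. \<bar>t - c\<bar> \<le> d \<longrightarrow> \<bar>(f ^^ i) t - (f ^^ i) c\<bar> < 1"
      using funpow_equicontinuous_at[OF f cI, of 1 0] by force
    then have "P 0 (0, d)" by (simp add: P_def W_iff)
    then show "\<exists>s. P 0 s" by blast
  next
    fix s j assume s: "P j s"
    obtain M d where Md: "s = (M, d)" by (cases s)
    have "d > 0" using s by (simp add: P_def Md)
    then obtain n where n: "n \<ge> 1" "\<bar>(f ^^ n) c - c\<bar> < d" "(f ^^ n) c \<noteq> z j M"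
      using rec by blast
    \<comment> \<open>Within \<open>e\<close> of \<open>(f ^^ n) c\<close> a point is still in \<open>W d\<close> and still different from \<open>z j M\<close>.\<close>
    define e where "e = min (1 / (real (Suc j) + 1))
        (min (d - \<bar>(f ^^ n) c - c\<bar>) \<bar>(f ^^ n) c - z j M\<bar>)"
    have "e > 0" using n by (auto simp: e_def)
    then obtain d' where d': "d' > 0"
      "\<And>i t. i \<le> M + n \<Longrightarrow> t \<in> W d' \<Longrightarrow> \<bar>(f ^^ i) t - (f ^^ i) c\<bar> < e"
      using funpow_equicontinuous_at[OF f cI, of e "M + n"] by (auto simp: W_iff)
    have "P (Suc j) (M + n, d')"
      using d' by (force simp: P_def e_def)
    moreover have "(f ^^ n) t \<in> W d - {z j M}" if "t \<in> W d'" for t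
    proof -
      have "\<bar>(f ^^ n) t - (f ^^ n) c\<bar> < e" using d'(2)[of n t] that by simp
      then show ?thesis
        using funpow_in_unit[OF f, of t n] that by (auto simp: W_iff e_def)
    qed
    then have "Q j s (M + n, d')"
      using n(1) by (auto simp: Q_def Md)
    ultimately show "\<exists>s'. P (Suc j) s' \<and> Q j s s'" by blast
  qed
  then obtain S where S: "\<And>j. P j (S j)" "\<And>j. Q j (S j) (S (Suc j))" by blast
  define M where "M j = fst (S j)" for j
  define V where "V j = W (snd (S j))" for j
  have small: "\<bar>(f ^^ i) t - (f ^^ i) c\<bar> < 1 / (real j + 1)" if "i \<le> M j" "t \<in> V j" for i j t
    using S(1)[of j] that by (auto simp: P_def M_def V_def)
  have cV: "c \<in> V j" for j
    using S(1)[of j] cI by (auto simp: P_def V_def W_iff)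
  have V: "closed (V j)" "connected (V j)" for j
    unfolding V_def W_def by (auto intro!: convex_connected convex_Int)
  have M_less: "M j < M (Suc j)"
    and V_step: "(f ^^ (M (Suc j) - M j)) ` V (Suc j) \<subseteq> V j - {z j (M j)}" for j
    using S(2)[of j] by (auto simp: Q_def M_def V_def)
  have smM: "strict_mono M" using M_less by (simp add: strict_mono_Suc_iff)
  then have Mge: "j \<le> M j" and Mmono: "i \<le> j \<Longrightarrow> M i \<le> M j" for i j
    by (simp_all add: strict_mono_imp_increasing strict_mono_less_eq)
  have back_in_V: "(f ^^ (M l - M j)) c \<in> V j" if "j \<le> l" for j l
  proof -
    have "(f ^^ (M l - M j)) ` V l \<subseteq> V j"
      using that
    proof (induction l rule: dec_induct)
      case (step l)
      have "M (Suc l) - M j = (M l - M j) + (M (Suc l) - M l)"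
        using Mmono[OF step(1)] M_less[of l] by simp
      then have "(f ^^ (M (Suc l) - M j)) ` V (Suc l)
          = (f ^^ (M l - M j)) ` ((f ^^ (M (Suc l) - M l)) ` V (Suc l))"
        by (simp only: funpow_add image_comp)
      then show ?case using V_step[of l] step(3) by blast
    qed simp
    then show ?thesis using cV by blast
  qed
  have cauchy: "\<bar>(f ^^ (M l - i)) c - (f ^^ (M j - i)) c\<bar> < 1 / (real j + 1)"
    if "j \<le> l" "i \<le> M j" for i j l
  proof -
    have "M l - i = (M j - i) + (M l - M j)" using Mmono[OF that(1)] that(2) by simp
    then show ?thesis
      using small[of "M j - i" j, OF _ back_in_V[OF that(1)]] by (simp add: funpow_add)
  qed
  \<comment> \<open>The backward histories of \<open>c\<close>, started at the levels \<open>M l\<close>, converge in each coordinate.\<close>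
  have "Cauchy (\<lambda>l. (f ^^ (M l - i)) c)" for i
  proof (rule metric_CauchyI)
    fix e :: real assume "e > 0"
    then obtain j0 where j0: "1 / (real j0 + 1) < e / 2"
      by (metis half_gt_zero nat_approx_posE of_nat_Suc add.commute)
    define j where "j = max i j0"
    have "1 / (real j + 1) \<le> 1 / (real j0 + 1)"
      by (simp add: j_def frac_le)
    then have j: "1 / (real j + 1) < e / 2" "i \<le> M j"
      using j0 Mge[of j] by (auto simp: j_def)
    have "dist ((f ^^ (M l - i)) c) ((f ^^ (M l' - i)) c) < e" if "l \<ge> j" "l' \<ge> j" for l l'
      using cauchy[OF that(1) j(2)] cauchy[OF that(2) j(2)] j(1) unfolding dist_real_def by linarith
    then show "\<exists>N. \<forall>l\<ge>N. \<forall>l'\<ge>N. dist ((f ^^ (M l - i)) c) ((f ^^ (M l' - i)) c) < e"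
      by blast
  qed
  then have "\<exists>y. (\<lambda>l. (f ^^ (M l - i)) c) \<longlonglongrightarrow> y" for i
    by (simp add: Cauchy_convergent_iff convergent_def)
  then obtain x where lim: "\<And>i. (\<lambda>l. (f ^^ (M l - i)) c) \<longlonglongrightarrow> x i"
    by metis
  have xI: "x i \<in> {0..1}" for i
    by (rule closed_sequentially[OF closed_atLeastAtMost _ lim]) (rule funpow_in_unit[OF f cI])
  have "f (x (Suc i)) = x i" for i
  proof (rule LIMSEQ_unique[OF _ lim])
    have "(\<lambda>l. f ((f ^^ (M l - Suc i)) c)) \<longlonglongrightarrow> f (x (Suc i))"
      by (rule continuous_on_tendsto_compose[OF _ lim xI])
        (use f funpow_in_unit[OF f cI] in \<open>auto simp: interval_map_def\<close>)
    moreover have "\<forall>\<^sub>F l in sequentially. f ((f ^^ (M l - Suc i)) c) = (f ^^ (M l - i)) c"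
    proof -
      have "f ((f ^^ (M l - Suc i)) c) = (f ^^ (M l - i)) c" if "l \<ge> Suc i" for l
      proof -
        have "M l - i = Suc (M l - Suc i)" using Mge[of l] that by simp
        then show ?thesis by simp
      qed
      then show ?thesis by (auto simp: eventually_sequentially)
    qed
    ultimately show "(\<lambda>l. (f ^^ (M l - i)) c) \<longlonglongrightarrow> f (x (Suc i))"
      by (rule Lim_transform_eventually)
  qed
  then have x: "x \<in> inverse_limit f"
    using xI by (simp add: inverse_limit_def)
  have xV: "x (M j) \<in> V j" for j
    by (rule Lim_in_closed_set[OF V(1) _ _ lim])
      (use back_in_V in \<open>auto simp: eventually_sequentially\<close>)
  have "endpoint_of (inverse_limit f) x"
  proof (rule endpoint_if_critical_nearby[OF f lz leo x c])
    fix n and e :: real assume "e > 0"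
    then obtain j0 where j0: "1 / (real j0 + 1) < e / 2"
      by (metis half_gt_zero nat_approx_posE of_nat_Suc add.commute)
    define j where "j = max (Suc n) j0"
    have "1 / (real j + 1) \<le> 1 / (real j0 + 1)"
      by (simp add: j_def frac_le)
    then have j: "1 / (real j + 1) < e / 2" "n < M j"
      using j0 Mge[of j] by (auto simp: j_def)
    let ?k = "M j - n"
    have xn: "(f ^^ ?k) (x (M j)) = x n"
      using inverse_limit_funpow[OF x, of ?k n] j(2) by simp
    have "\<bar>(f ^^ ?k) t - x n\<bar> < e" if "t \<in> V j" for t
      using small[of ?k j t] small[of ?k j "x (M j)"] that xV[of j] j(1) unfolding xn by linarith
    then show "\<exists>k\<ge>1. \<exists>W. connected W \<and> x (n + k) \<in> W \<and> c \<in> W \<and> (\<forall>t\<in>W. \<bar>(f ^^ k) t - x n\<bar> < e)"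
      using j(2) V(2) xV cV by (intro exI[of _ ?k] conjI exI[of _ "V j"]) auto
  qed
  moreover have "x \<noteq> z j" for j
  proof -
    have "x (M j) = (f ^^ (M (Suc j) - M j)) (x (M (Suc j)))"
      using inverse_limit_funpow[OF x, of "M (Suc j) - M j" "M j"] M_less[of j] by simp
    then have "x (M j) \<noteq> z j (M j)"
      using V_step[of j] xV[of "Suc j"] by blast
    then show ?thesis by auto
  qed
  ultimately show thesis using that by blast
qed

section \<open>Recurrence and the orbit\<close>

lemma omega_limit_returns:
  assumes "c \<in> omega_limit f c" "e > 0"
  shows "\<exists>n>m. \<bar>(f ^^ n) c - c\<bar> < e"
proof -
  obtain r where r: "strict_mono r" "(\<lambda>k. (f ^^ r k) c) \<longlonglongrightarrow> c"
    using assms(1) by (auto simp: omega_limit_def)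
  obtain K where K: "\<And>k. k \<ge> K \<Longrightarrow> \<bar>(f ^^ r k) c - c\<bar> < e"
    using LIMSEQ_D[OF r(2) assms(2)] by auto
  have "m < r (max K (Suc m))"
    using strict_mono_imp_increasing[OF r(1), of "max K (Suc m)"] by simp
  then show ?thesis using K[of "max K (Suc m)"] by auto
qed

text \<open>
  If two iterates agree, the orbit is eventually periodic and all its points occur before the
  second coincidence.
\<close>
lemma inj_iterates_if_infinite_orb:
  assumes "infinite (orb f c)" and "(f ^^ m) c = (f ^^ n) c"
  shows "m = n"
proof -
  have False if "m < n" "(f ^^ m) c = (f ^^ n) c" for m n
  proof -
    have per: "(f ^^ (k + (n - m))) c = (f ^^ k) c" if "k \<ge> m" for k
    proof -
      have "k + (n - m) = (k - m) + n" "k = (k - m) + m" using that \<open>m < n\<close> by simp_all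
      then show ?thesis
        using \<open>(f ^^ m) c = (f ^^ n) c\<close> by (metis comp_apply funpow_add)
    qed
    have "(f ^^ k) c \<in> (\<lambda>i. (f ^^ i) c) ` {..<n}" for k
    proof (induction k rule: less_induct)
      case (less k)
      show ?case
      proof (cases "k < n")
        case False
        then have "(f ^^ k) c = (f ^^ (k - (n - m))) c"
          using per[of "k - (n - m)"] \<open>m < n\<close> by simp
        then show ?thesis using less[of "k - (n - m)"] False \<open>m < n\<close> by simp
      qed simp
    qed
    then have "orb f c \<subseteq> (\<lambda>i. (f ^^ i) c) ` {..<n}" by (auto simp: orb_def)
    then show False using assms(1) finite_subset by blast
  qed
  then show ?thesis using assms(2) by (metis linorder_neqE_nat)
qed

theorem theorem7p3:
  fixes f :: "real \<Rightarrow> real" and c :: real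
  assumes "interval_map f"
    and "long_zigzag f"
    and "locally_eventually_onto f"
    and "c \<in> critical_set f"
    and "c \<in> omega_limit f c"
  shows "(\<exists>x. endpoint_of (inverse_limit f) x) \<and>
    (infinite (orb f c) \<longrightarrow> uncountable {x. endpoint_of (inverse_limit f) x})"
proof
  have cI: "c \<in> {0..1}"
    using assms(4) by (auto simp: critical_set_def critical_point_def)
  \<comment> \<open>Existence has no point to avoid: the number 2 is outside the unit interval.\<close>
  have "\<exists>n\<ge>1. \<bar>(f ^^ n) c - c\<bar> < e \<and> (f ^^ n) c \<noteq> 2" if "e > 0" for e
  proof -
    obtain n where n: "n > 0" "\<bar>(f ^^ n) c - c\<bar> < e"
      using omega_limit_returns[OF assms(5) \<open>e > 0\<close>] by blast
    moreover have "(f ^^ n) c \<noteq> 2"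
      using funpow_in_unit[OF assms(1) cI, of n] by auto
    ultimately show ?thesis by (auto simp: Suc_le_eq)
  qed
  then show ex: "\<exists>x. endpoint_of (inverse_limit f) x"
    using recurrent_critical_endpoint_avoiding[OF assms(1-4), of "\<lambda>_ _. 2"] by metis
  show "infinite (orb f c) \<longrightarrow> uncountable {x. endpoint_of (inverse_limit f) x}"
  proof (intro impI notI)
    assume inf: "infinite (orb f c)" and "countable {x. endpoint_of (inverse_limit f) x}"
    then obtain z :: "nat \<Rightarrow> nat \<Rightarrow> real" where z: "{x. endpoint_of (inverse_limit f) x} = range z"
      using ex range_from_nat_into by (metis (no_types, lifting) empty_Collect_eq)
    have "\<exists>n\<ge>1. \<bar>(f ^^ n) c - c\<bar> < e \<and> (f ^^ n) c \<noteq> z j m" if "e > 0" for e j m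
    proof -
      obtain n where n: "n > 0" "\<bar>(f ^^ n) c - c\<bar> < e"
        using omega_limit_returns[OF assms(5) \<open>e > 0\<close>] by blast
      obtain n' where n': "n' > n" "\<bar>(f ^^ n') c - c\<bar> < e"
        using omega_limit_returns[OF assms(5) \<open>e > 0\<close>] by blast
      have "(f ^^ n) c \<noteq> (f ^^ n') c"
        using inj_iterates_if_infinite_orb[OF inf] n'(1) by blast
      then have "(f ^^ n) c \<noteq> z j m \<or> (f ^^ n') c \<noteq> z j m" by metis
      then show ?thesis
        using n n' by (metis less_imp_le_nat less_one not_less order.strict_trans)
    qed
    then obtain x where "endpoint_of (inverse_limit f) x" "\<And>j. x \<noteq> z j"
      using recurrent_critical_endpoint_avoiding[OF assms(1-4)] by metis
    then show False using z by blast
  qed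
qed

end
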